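(* The dominating ideal $DI(K_{r,s})$ of every complete bipartite graph $K_{r,s}$ is nearly normally torsion-free.
   Context: For a finite simple graph $G$ with vertex set $\{1,\ldots,n\}$, let $N_G[v]=\{v\}\cup\{u:\{u,v\}\in E(G)\}$. A subset $S\subseteq V(G)$ is a dominating set of $G$ if $S\cap N_G[v]\ne\emptyset$ for every $v\in V(G)$; it is a minimal dominating set if moreover no proper subset of it is a dominating set. The dominating ideal of $G$ is $DI(G)=\bigl(\prod_{i\in S}x_i : S \text{ a minimal dominating set of } G\bigr)\subset R=K[x_1,\ldots,x_n]$, $K$ a field. A monomial ideal $I$ in a polynomial ring $R$ is nearly normally torsion-free if there exist a positive integer $k$ and a monomial prime ideal $\mathfrak{p}$ such that $\mathrm{Ass}_R(R/I^m)=\mathrm{Min}(I)$ for all $1\le m\le k$, and $\mathrm{Ass}_R(R/I^m)\subseteq\mathrm{Min}(I)\cup\{\mathfrak{p}\}$ for all $m\ge k+1$, where $\mathrm{Min}(I)$ is the set of minimal primes of $I$. *)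

theory Defs
  imports
    "HOL-Library.Poly_Mapping"
    "HOL-Algebra.Ideal_Product"
    "HOL-Algebra.QuotRing"
    "HOL-Algebra.Module"
    "Graph_Theory.Graph_Theory"
begin

section \<open>Polynomial rings and monomial ideals\<close>

text \<open>
  A polynomial with variables in \<open>'v\<close> and coefficients in \<open>'k\<close> is a finitely supported map from
  exponent vectors (finitely supported maps \<open>'v \<Rightarrow> nat\<close>) to coefficients. The set \<open>V\<close> of variables
  that may occur is part of the carrier, so that \<open>mpoly_ring {1..n}\<close> is $K[x_1, \dots, x_n]$.
\<close>

type_synonym ('v, 'k) mpoly = "('v \<Rightarrow>\<^sub>0 nat) \<Rightarrow>\<^sub>0 'k"

definition mpoly_ring :: "'v set \<Rightarrow> ('v, 'k::field) mpoly ring" where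
  "mpoly_ring V =
    \<lparr>carrier = {f. \<forall>m \<in> Poly_Mapping.keys f. Poly_Mapping.keys m \<subseteq> V},
     monoid.mult = (*), one = 1, zero = 0, add = (+)\<rparr>"

lemma mpoly_ring_cring: "cring (mpoly_ring V :: ('v, 'k::field) mpoly ring)"
proof (rule cringI)
  let ?R = "mpoly_ring V :: ('v, 'k) mpoly ring"
  have add: "f + g \<in> carrier ?R" if "f \<in> carrier ?R" "g \<in> carrier ?R" for f g
    using that Poly_Mapping.keys_add[of f g] by (auto simp: mpoly_ring_def)
  have mult: "f * g \<in> carrier ?R" if fg: "f \<in> carrier ?R" "g \<in> carrier ?R" for f g
  proof -
    have "Poly_Mapping.keys m \<subseteq> V" if m: "m \<in> Poly_Mapping.keys (f * g)" for m
    proof -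
      obtain a b where "m = a + b" "a \<in> Poly_Mapping.keys f" "b \<in> Poly_Mapping.keys g"
        using m Poly_Mapping.keys_mult[of f g] by blast
      moreover from this have "Poly_Mapping.keys a \<subseteq> V" "Poly_Mapping.keys b \<subseteq> V"
        using fg by (simp_all add: mpoly_ring_def)
      ultimately show ?thesis
        using Poly_Mapping.keys_add[of a b] by (metis Un_least order_trans)
    qed
    then show ?thesis by (simp add: mpoly_ring_def)
  qed
  have neg: "- f \<in> carrier ?R" if "f \<in> carrier ?R" for f
    using that by (simp add: mpoly_ring_def)
  have zero: "0 \<in> carrier ?R" and one: "1 \<in> carrier ?R"
    by (simp_all add: mpoly_ring_def)
  have ops: "x \<oplus>\<^bsub>?R\<^esub> y = x + y" "x \<otimes>\<^bsub>?R\<^esub> y = x * y" "\<zero>\<^bsub>?R\<^esub> = 0" "\<one>\<^bsub>?R\<^esub> = 1" for x y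
    by (simp_all add: mpoly_ring_def)
  show "abelian_group ?R"
  proof (rule abelian_groupI)
    fix f assume "f \<in> carrier ?R"
    then show "\<exists>g \<in> carrier ?R. g \<oplus>\<^bsub>?R\<^esub> f = \<zero>\<^bsub>?R\<^esub>"
      by (intro bexI[of _ "- f"] neg) (simp_all add: ops)
  qed (simp_all add: ops add zero add_ac)
  show "Group.comm_monoid ?R"
    by (rule comm_monoidI) (simp_all add: ops mult one mult_ac)
  show "(x \<oplus>\<^bsub>?R\<^esub> y) \<otimes>\<^bsub>?R\<^esub> z = x \<otimes>\<^bsub>?R\<^esub> z \<oplus>\<^bsub>?R\<^esub> y \<otimes>\<^bsub>?R\<^esub> z" for x y z
    by (simp add: ops distrib_right)
qed

definition var :: "'v \<Rightarrow> ('v, 'k::field) mpoly" where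
  "var v = Poly_Mapping.single (Poly_Mapping.single v 1) 1"

definition monomials :: "'v set \<Rightarrow> ('v, 'k::field) mpoly set" where
  "monomials V = {Poly_Mapping.single m 1 | m. Poly_Mapping.keys m \<subseteq> V}"

definition monomial_ideal :: "'v set \<Rightarrow> ('v, 'k::field) mpoly set \<Rightarrow> bool" where
  "monomial_ideal V I \<longleftrightarrow> (\<exists>M. M \<subseteq> monomials V \<and> I = Idl\<^bsub>mpoly_ring V\<^esub> M)"


section \<open>Associated and minimal primes\<close>

definition quotient_module :: "('a, 'c) ring_scheme \<Rightarrow> 'a set \<Rightarrow> ('a, 'a set) module" where
  "quotient_module R I =
    \<lparr>carrier = carrier (R Quot I), monoid.mult = monoid.mult (R Quot I), one = one (R Quot I),
     zero = zero (R Quot I), add = add (R Quot I),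
     smult = (\<lambda>r A. (I +>\<^bsub>R\<^esub> r) \<otimes>\<^bsub>R Quot I\<^esub> A)\<rparr>"

definition annihilator :: "('a, 'c) ring_scheme \<Rightarrow> ('a, 'b, 'd) module_scheme \<Rightarrow> 'b \<Rightarrow> 'a set" where
  "annihilator R M x = {r \<in> carrier R. r \<odot>\<^bsub>M\<^esub> x = \<zero>\<^bsub>M\<^esub>}"

definition associated_primes :: "('a, 'c) ring_scheme \<Rightarrow> ('a, 'b, 'd) module_scheme \<Rightarrow> 'a set set" where
  "associated_primes R M = {\<pp>. primeideal \<pp> R \<and> (\<exists>x \<in> carrier M. \<pp> = annihilator R M x)}"

definition minimal_primes :: "('a, 'c) ring_scheme \<Rightarrow> 'a set \<Rightarrow> 'a set set" where
  "minimal_primes R I =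
    {\<pp>. primeideal \<pp> R \<and> I \<subseteq> \<pp> \<and> (\<forall>\<qq>. primeideal \<qq> R \<and> I \<subseteq> \<qq> \<and> \<qq> \<subseteq> \<pp> \<longrightarrow> \<qq> = \<pp>)}"

text \<open>
  Powers of ideals are taken in the multiplicative monoid of \<^term>\<open>ideals_set R\<close>, whose product is
  the ideal product.
\<close>

definition nearly_normally_torsion_free :: "'v set \<Rightarrow> ('v, 'k::field) mpoly set \<Rightarrow> bool" where
  "nearly_normally_torsion_free V I \<longleftrightarrow>
    (let R = mpoly_ring V;
         Ass = (\<lambda>m::nat. associated_primes R (quotient_module R (I [^]\<^bsub>ideals_set R\<^esub> m)))
     in monomial_ideal V I \<and>
        (\<exists>k::nat. \<exists>\<pp>. k \<ge> 1 \<and> primeideal \<pp> R \<and> monomial_ideal V \<pp> \<and>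
          (\<forall>m. 1 \<le> m \<and> m \<le> k \<longrightarrow> Ass m = minimal_primes R I) \<and>
          (\<forall>m. m \<ge> k + 1 \<longrightarrow> Ass m \<subseteq> minimal_primes R I \<union> {\<pp>})))"


section \<open>Dominating ideals\<close>

text \<open>
  Finite simple graphs are modelled as in the Graph Theory library, by the locale \<^locale>\<open>graph\<close>
  of finite loop-free symmetric digraphs without parallel arcs; an edge $\{u,v\}$ is the pair of
  arcs \<open>(u, v)\<close> and \<open>(v, u)\<close>.
\<close>

definition closed_nbhd :: "('v, 'e) pre_digraph \<Rightarrow> 'v \<Rightarrow> 'v set" where
  "closed_nbhd G v = {v} \<union> {u. v \<rightarrow>\<^bsub>G\<^esub> u}"

definition dominating_set :: "('v, 'e) pre_digraph \<Rightarrow> 'v set \<Rightarrow> bool" where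
  "dominating_set G S \<longleftrightarrow> S \<subseteq> verts G \<and> (\<forall>v \<in> verts G. S \<inter> closed_nbhd G v \<noteq> {})"

definition minimal_dominating_set :: "('v, 'e) pre_digraph \<Rightarrow> 'v set \<Rightarrow> bool" where
  "minimal_dominating_set G S \<longleftrightarrow>
    dominating_set G S \<and> (\<forall>T. T \<subset> S \<longrightarrow> \<not> dominating_set G T)"

definition dominating_ideal :: "('v, 'e) pre_digraph \<Rightarrow> ('v, 'k::field) mpoly set" where
  "dominating_ideal G =
    Idl\<^bsub>mpoly_ring (verts G)\<^esub> {\<Prod>v\<in>S. var v | S. minimal_dominating_set G S}"

end

theory Submission
  imports Defs
begin

text \<open>
  Let the bipartition be \<open>A \<union> B\<close>. A monomial lies in the dominating ideal \<open>I\<close> iff its support dominates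
  the graph, that is, meets every closed neighbourhood. So \<open>I\<close> is the intersection of the primes
  \<open>(x_u : u \<in> N[v])\<close>, and for a complete bipartite graph \<open>N[a] = {a} \<union> B\<close> for \<open>a \<in> A\<close> and
  \<open>N[b] = {b} \<union> A\<close> for \<open>b \<in> B\<close>. Being an intersection of finitely many primes, \<open>I\<close> satisfies
  \<open>Ass(R/I) = Min(I)\<close>, which allows the threshold \<open>k = 1\<close>. The exceptional prime is the ideal
  generated by all variables.

  For the powers, use that \<open>I\<close> is generated by the product of the variables in \<open>A\<close>, the product of those
  in \<open>B\<close>, and the products \<open>x_a x_b\<close>. Take \<open>P = (I^m : f)\<close> prime, so that \<open>I \<subseteq> P\<close>. If \<open>P\<close> contains all variables, it is the ideal that they
  generate. Otherwise some variable, say \<open>x_v\<close> with \<open>v \<in> A\<close>, is not in \<open>P\<close>, and \<open>x_v\<close> can be inverted.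
  This turns the edge products \<open>x_v x_b\<close> into the variables \<open>x_b\<close> and the product over \<open>A\<close> into the
  product over \<open>A - {v}\<close>, and the powers of the resulting ideal are the intersections of the powers
  \<open>(x_a, x_b : b \<in> B)^m\<close> over \<open>a \<in> A - {v}\<close>. Without fractions, this says that \<open>x_v^m\<close> multiplies that
  intersection into \<open>I^m\<close> (lemma \<open>localised_power\<close>), and since \<open>x_v \<notin> P\<close>, \<open>P\<close> is the colon ideal of the
  intersection as well. A prime that is a colon ideal of a finite intersection is a colon ideal of one
  of the parts (\<open>prime_colon_Inter\<close>), and a power of an ideal generated by variables is primary
  (\<open>vars_power_primary\<close>). Hence \<open>P\<close> is contained in one of the primes \<open>(x_a, x_b : b \<in> B)\<close>. These are
  minimal over \<open>I\<close> when \<open>a \<noteq> v\<close>, so \<open>P\<close> is equal to it.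
\<close>

section \<open>Colon ideals and associated primes of quotients\<close>

definition colon :: "('a, 'c) ring_scheme \<Rightarrow> 'a set \<Rightarrow> 'a \<Rightarrow> 'a set" where
  "colon R I f = {g \<in> carrier R. g \<otimes>\<^bsub>R\<^esub> f \<in> I}"

lemma (in ideal) annihilator_quotient:
  assumes "f \<in> carrier R"
  shows "annihilator R (quotient_module R I) (I +> f) = colon R I f"
proof -
  have "I +> (g \<otimes> f) = I \<longleftrightarrow> g \<otimes> f \<in> I" if "g \<in> carrier R" for g
    using that assms a_rcos_const a_rcos_self by (metis m_closed)
  then show ?thesis
    using assms unfolding annihilator_def colon_def
    by (intro Collect_cong conj_cong refl)
      (simp add: quotient_module_def FactRing_def rcoset_mult_add)
qed

lemma (in ideal) associated_primes_quotient:
  "associated_primes R (quotient_module R I) =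
    {P. primeideal P R \<and> (\<exists>f \<in> carrier R. P = colon R I f)}"
proof -
  have "carrier (quotient_module R I) = (\<lambda>f. I +> f) ` carrier R"
    by (auto simp: quotient_module_def FactRing_def A_RCOSETS_def')
  then show ?thesis
    by (auto simp: associated_primes_def annihilator_quotient)
qed

lemma (in cring) colon_ideal:
  assumes "ideal I R" "f \<in> carrier R"
  shows "ideal (colon R I f) R"
proof -
  interpret I: ideal I R by fact
  show ?thesis
  proof (rule idealI)
    show "ring R" by (rule ring_axioms)
    show "subgroup (colon R I f) (add_monoid R)"
    proof (rule add.subgroupI)
      show "colon R I f \<subseteq> carrier R" by (auto simp: colon_def)
      have "\<zero> \<in> colon R I f" using assms by (simp add: colon_def)
      then show "colon R I f \<noteq> {}" by blast
      show "\<ominus> a \<in> colon R I f" if "a \<in> colon R I f" for a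
        using that assms by (simp add: colon_def l_minus)
      show "a \<oplus> b \<in> colon R I f" if "a \<in> colon R I f" "b \<in> colon R I f" for a b
        using that assms by (simp add: colon_def l_distr)
    qed
    show "x \<otimes> a \<in> colon R I f" if "a \<in> colon R I f" "x \<in> carrier R" for a x
      using that assms by (simp add: colon_def m_assoc I.I_l_closed)
    show "a \<otimes> x \<in> colon R I f" if "a \<in> colon R I f" "x \<in> carrier R" for a x
      using that assms by (simp add: colon_def m_assoc m_comm[of a x] I.I_l_closed)
  qed
qed

text \<open>
  Choose an element outside the prime from each of the ideals; their product lies in all the ideals, but
  not in the prime.
\<close>

lemma (in primeideal) finite_Inter_witness:
  assumes "finite F" "\<And>Q. Q \<in> F \<Longrightarrow> ideal Q R" "\<And>Q. Q \<in> F \<Longrightarrow> \<not> Q \<subseteq> I"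
  shows "\<exists>y \<in> carrier R. y \<notin> I \<and> (\<forall>Q \<in> F. y \<in> Q)"
  using assms
proof (induction F rule: finite_induct)
  case empty
  show ?case using I_notcarr a_subset by auto
next
  case (insert Q F)
  obtain y where y: "y \<in> carrier R" "y \<notin> I" "\<forall>Q \<in> F. y \<in> Q"
    using insert by auto
  obtain z where z: "z \<in> Q" "z \<notin> I"
    using insert.prems(2) by blast
  interpret Q: ideal Q R using insert.prems(1) by blast
  have zc: "z \<in> carrier R" using z by simp
  have "z \<otimes> y \<notin> I" using I_prime y z zc by blast
  moreover have "z \<otimes> y \<in> Q" using z y by (simp add: Q.I_r_closed)
  moreover have "z \<otimes> y \<in> Q'" if "Q' \<in> F" for Q'
    using that y zc insert.prems(1) by (simp add: ideal.I_l_closed)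
  ultimately show ?case using y zc by (intro bexI[of _ "z \<otimes> y"]) auto
qed

text \<open>
  Forming colon ideals commutes with intersections, so the prime is a finite intersection of the ideals
  \<open>(Q : f)\<close>; it contains one of them, and is contained in each.
\<close>

lemma (in cring) prime_colon_Inter:
  assumes F: "finite F" "\<And>Q. Q \<in> F \<Longrightarrow> ideal Q R"
    and I: "I = {g \<in> carrier R. \<forall>Q \<in> F. g \<in> Q}"
    and f: "f \<in> carrier R" and prime: "primeideal (colon R I f) R"
  shows "\<exists>Q \<in> F. colon R I f = colon R Q f"
proof (rule ccontr)
  assume contra: "\<not> ?thesis"
  have "\<not> colon R Q f \<subseteq> colon R I f" if "Q \<in> F" for Q
  proof -
    have "colon R I f \<subseteq> colon R Q f"
      using that by (auto simp: colon_def I)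
    then show ?thesis using contra that by auto
  qed
  then have "\<exists>y \<in> carrier R. y \<notin> colon R I f \<and> (\<forall>Q \<in> (\<lambda>Q. colon R Q f) ` F. y \<in> Q)"
    using F f by (intro primeideal.finite_Inter_witness[OF prime]) (auto intro: colon_ideal)
  then show False using f by (auto simp: colon_def I)
qed

lemma (in cring) colon_primeideal:
  assumes "primeideal Q R" "f \<in> carrier R" "f \<notin> Q"
  shows "colon R Q f = Q"
proof -
  interpret Q: primeideal Q R by fact
  show ?thesis
    using assms(2,3) Q.I_prime Q.I_r_closed by (auto simp: colon_def)
qed

text \<open>
  For an intersection of finitely many primes, \<open>(I : f)\<close> is the intersection of those \<open>Q \<in> F\<close> that do not
  contain \<open>f\<close>. An associated prime is therefore one of the \<open>Q\<close>; conversely a minimal prime \<open>P\<close> is \<open>(I : y)\<close>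
  for any \<open>y\<close> outside \<open>P\<close> that lies in all other members of \<open>F\<close>. The family may contain non-minimal primes,
  as the neighbourhood primes of a star with two or more leaves do.
\<close>

lemma (in cring) associated_primes_Inter_primes:
  assumes F: "finite F" "\<And>Q. Q \<in> F \<Longrightarrow> primeideal Q R"
    and I: "I = {g \<in> carrier R. \<forall>Q \<in> F. g \<in> Q}" "ideal I R"
  shows "associated_primes R (quotient_module R I) = minimal_primes R I"
proof (intro Set.set_eqI iffI)
  fix P assume "P \<in> associated_primes R (quotient_module R I)"
  then obtain f where P: "primeideal P R" and f: "f \<in> carrier R" "P = colon R I f"
    by (auto simp: ideal.associated_primes_quotient[OF I(2)])
  interpret P: primeideal P R by fact
  have "\<exists>Q \<in> F. P = colon R Q f"
    unfolding f(2)
  proof (rule prime_colon_Inter[OF F(1) _ I(1) f(1)])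
    show "ideal Q R" if "Q \<in> F" for Q using F(2)[OF that] by (rule primeideal.axioms(1))
    show "primeideal (colon R I f) R" using P f(2) by simp
  qed
  then obtain Q where Q: "Q \<in> F" "P = colon R Q f" by (rule bexE)
  have Q_ideal: "ideal Q R" using F(2)[OF Q(1)] by (rule primeideal.axioms(1))
  have "f \<notin> Q"
  proof
    assume "f \<in> Q"
    then have "carrier R \<subseteq> P"
      unfolding Q(2) colon_def by (intro subsetI CollectI conjI ideal.I_l_closed[OF Q_ideal])
    from equalityI[OF this P.a_subset] show False
      by (rule notE[OF P.I_notcarr])
  qed
  then have PQ: "P = Q" using colon_primeideal[OF F(2)[OF Q(1)] f(1)] Q(2) by simp
  \<comment> \<open>As \<open>P \<otimes> f \<subseteq> I \<subseteq> Q'\<close> and \<open>f \<notin> Q'\<close>, the whole of \<open>P\<close> lies in \<open>Q'\<close>.\<close>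
  have "Q' = P" if Q': "primeideal Q' R" "I \<subseteq> Q'" "Q' \<subseteq> P" for Q'
  proof -
    have "g \<in> Q'" if g: "g \<in> P" for g
    proof -
      have "g \<otimes> f \<in> Q'" using g Q'(2) unfolding f(2) colon_def by blast
      moreover have "f \<notin> Q'" using Q'(3) PQ \<open>f \<notin> Q\<close> by blast
      ultimately show ?thesis
        using primeideal.I_prime[OF Q'(1) P.a_Hcarr[OF g] f(1)] by simp
    qed
    then show ?thesis using Q'(3) by blast
  qed
  then show "P \<in> minimal_primes R I"
    using P PQ Q(1) I(1) by (auto simp: minimal_primes_def)
next
  fix P assume P: "P \<in> minimal_primes R I"
  then have IP: "I \<subseteq> P" and min: "\<And>Q. primeideal Q R \<Longrightarrow> I \<subseteq> Q \<Longrightarrow> Q \<subseteq> P \<Longrightarrow> Q = P"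
    and "primeideal P R"
    by (auto simp: minimal_primes_def)
  interpret P: primeideal P R by fact
  have sub: "I \<subseteq> Q" if "Q \<in> F" for Q using that I(1) by blast
  have "\<not> Q \<subseteq> P" if "Q \<in> F - {P}" for Q
    using that min[OF F(2) sub, of Q] by auto
  then have "\<exists>y \<in> carrier R. y \<notin> P \<and> (\<forall>Q \<in> F - {P}. y \<in> Q)"
    using F by (intro P.finite_Inter_witness) (auto intro: primeideal.axioms(1))
  then obtain y where y: "y \<in> carrier R" "y \<notin> P" "\<forall>Q \<in> F - {P}. y \<in> Q"
    by blast
  have "P \<in> F"
    using y IP I(1) by blast
  have "colon R I y = P"
  proof
    show "colon R I y \<subseteq> P"
      using IP y P.I_prime by (auto simp: colon_def)
    show "P \<subseteq> colon R I y"
    proof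
      fix g assume g: "g \<in> P"
      have "g \<otimes> y \<in> Q" if "Q \<in> F" for Q
      proof (cases "Q = P")
        case True
        then show ?thesis using P.I_r_closed[OF g y(1)] by simp
      next
        case False
        then have "y \<in> Q" using that y(3) by simp
        then show ?thesis
          using ideal.I_l_closed[OF primeideal.axioms(1)[OF F(2)[OF that]] _ P.a_Hcarr[OF g]]
          by simp
      qed
      then show "g \<in> colon R I y" using g y(1) by (simp add: colon_def I(1))
    qed
  qed
  then show "P \<in> associated_primes R (quotient_module R I)"
    using \<open>primeideal P R\<close> y(1) by (auto simp: ideal.associated_primes_quotient[OF I(2)])
qed


section \<open>Powers of ideals\<close>

lemma ideals_set_simps [simp]:
  "\<one>\<^bsub>ideals_set R\<^esub> = carrier R"
  "I \<otimes>\<^bsub>ideals_set R\<^esub> J = ideal_prod R I J"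
  by (simp_all add: ideals_set_def)

lemma (in ring) ideal_power_ideal:
  assumes "ideal I R"
  shows "ideal (I [^]\<^bsub>ideals_set R\<^esub> (m::nat)) R"
  by (induction m) (simp_all add: oneideal ideal_prod_is_ideal assms)

lemma (in primeideal) nat_pow_mem:
  assumes "y \<in> carrier R" "y [^] (m::nat) \<in> I"
  shows "y \<in> I"
  using assms(2)
proof (induction m)
  case 0
  then show ?case using one_imp_carrier I_notcarr by auto
next
  case (Suc m)
  then show ?case using I_prime[of "y [^] m" y] assms(1) by auto
qed

lemma (in primeideal) contains_base_of_power:
  assumes "ideal J R" "J [^]\<^bsub>ideals_set R\<^esub> (m::nat) \<subseteq> I"
  shows "J \<subseteq> I"
proof
  fix y assume y: "y \<in> J"
  then have yc: "y \<in> carrier R" using assms(1) by (simp add: ideal.Icarr)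
  have "y [^] m \<in> J [^]\<^bsub>ideals_set R\<^esub> m"
    using y by (induction m) (auto intro: ideal_prod.prod)
  then show "y \<in> I" using assms(2) nat_pow_mem[OF yc] by blast
qed


section \<open>Powers of ideals generated by variables\<close>

lemma mpoly_ring_simps [simp]:
  "f \<otimes>\<^bsub>mpoly_ring V\<^esub> g = f * g" "f \<oplus>\<^bsub>mpoly_ring V\<^esub> g = f + g"
  "\<zero>\<^bsub>mpoly_ring V\<^esub> = 0" "\<one>\<^bsub>mpoly_ring V\<^esub> = 1"
  by (simp_all add: mpoly_ring_def)

lemma mpoly_ring_nat_pow [simp]: "f [^]\<^bsub>mpoly_ring V\<^esub> (m::nat) = f ^ m"
  by (induction m) (simp_all add: mult.commute)

lemma in_mpoly_ring:
  "f \<in> carrier (mpoly_ring V) \<longleftrightarrow> (\<forall>k \<in> Poly_Mapping.keys f. Poly_Mapping.keys k \<subseteq> V)"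
  by (simp add: mpoly_ring_def)

lemma single_in_mpoly_ring:
  "Poly_Mapping.keys k \<subseteq> V \<Longrightarrow> Poly_Mapping.single k c \<in> carrier (mpoly_ring V)"
  by (simp add: in_mpoly_ring)

lemma sum_single_keys:
  "(\<Sum>k \<in> Poly_Mapping.keys f. Poly_Mapping.single k (Poly_Mapping.lookup f k)) = f"
  by (rule poly_mapping_eqI)
    (auto simp: lookup_sum lookup_single when_def in_keys_iff sum.delta')

lemma ideal_memI_monomials:
  assumes J: "ideal J (mpoly_ring V)" and f: "f \<in> carrier (mpoly_ring V)"
    and mono: "\<And>k. k \<in> Poly_Mapping.keys f \<Longrightarrow> Poly_Mapping.single k 1 \<in> J"
  shows "f \<in> J"
proof -
  interpret ideal J "mpoly_ring V" by fact
  have "(\<Sum>k \<in> K. Poly_Mapping.single k (Poly_Mapping.lookup f k)) \<in> J"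
    if "finite K" "K \<subseteq> Poly_Mapping.keys f" for K
    using that
  proof (induction K rule: finite_induct)
    case empty
    then show ?case
      using additive_subgroup.zero_closed[OF ideal.axioms(1)[OF J]] by simp
  next
    case (insert k K)
    have "Poly_Mapping.single 0 (Poly_Mapping.lookup f k) * Poly_Mapping.single k 1 \<in> J"
      using I_l_closed[OF mono single_in_mpoly_ring[of 0 V]] insert.prems by simp
    then have "Poly_Mapping.single k (Poly_Mapping.lookup f k) \<in> J"
      by (simp add: mult_single)
    then show ?case
      using insert additive_subgroup.a_closed[OF ideal.axioms(1)[OF J]] by simp
  qed
  then show ?thesis using sum_single_keys[of f] by (metis finite_keys order_refl)
qed

definition degree_in :: "'v set \<Rightarrow> ('v \<Rightarrow>\<^sub>0 nat) \<Rightarrow> nat" where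
  "degree_in S k = (\<Sum>i\<in>S. Poly_Mapping.lookup k i)"

lemma degree_in_0 [simp]: "degree_in S 0 = 0"
  by (simp add: degree_in_def)

lemma degree_in_add: "degree_in S (k + l) = degree_in S k + degree_in S l"
  by (simp add: degree_in_def lookup_add sum.distrib)

lemma degree_in_pos:
  "finite S \<Longrightarrow> 1 \<le> degree_in S k \<longleftrightarrow> Poly_Mapping.keys k \<inter> S \<noteq> {}"
  using sum_eq_0_iff[of S "Poly_Mapping.lookup k"]
  by (fastforce simp: degree_in_def in_keys_iff Suc_le_eq)

lemma degree_in_single:
  "finite S \<Longrightarrow> degree_in S (Poly_Mapping.single i c) = (if i \<in> S then c else 0)"
  by (simp add: degree_in_def lookup_single when_def)

lemma lookup_le_degree_in:
  "finite S \<Longrightarrow> i \<in> S \<Longrightarrow> Poly_Mapping.lookup k i \<le> degree_in S k"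
  unfolding degree_in_def by (rule member_le_sum) auto

text \<open>
  For finite \<open>S \<subseteq> V\<close>, the \<open>d\<close>-th power of the prime ideal generated by the variables in \<open>S\<close>, described by its monomials:
  those of degree at least \<open>d\<close> in these variables. In this form it is a step of a filtration by order of
  vanishing, which makes primality and primariness accessible.
\<close>

definition vars_power :: "'v set \<Rightarrow> 'v set \<Rightarrow> nat \<Rightarrow> ('v, 'k::field) mpoly set" where
  "vars_power V S d =
    {f \<in> carrier (mpoly_ring V). \<forall>k \<in> Poly_Mapping.keys f. d \<le> degree_in S k}"

lemma vars_power_0 [simp]: "vars_power V S 0 = carrier (mpoly_ring V)"
  by (simp add: vars_power_def)

lemma vars_power_mult:
  assumes "f \<in> vars_power V S i" "g \<in> vars_power V S j"
  shows "f * g \<in> vars_power V S (i + j)"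
proof -
  interpret cring "mpoly_ring V" by (rule mpoly_ring_cring)
  have "f * g \<in> carrier (mpoly_ring V)"
    using assms m_closed[of f g] by (simp add: vars_power_def)
  moreover have "i + j \<le> degree_in S k" if "k \<in> Poly_Mapping.keys (f * g)" for k
    using that keys_mult[of f g] assms by (fastforce simp: vars_power_def degree_in_add add_mono)
  ultimately show ?thesis by (simp add: vars_power_def)
qed

lemma vars_power_ideal: "ideal (vars_power V S d) (mpoly_ring V :: ('v, 'k::field) mpoly ring)"
proof -
  interpret cring "mpoly_ring V :: ('v, 'k::field) mpoly ring" by (rule mpoly_ring_cring)
  show ?thesis
  proof (rule idealI)
    show "ring (mpoly_ring V :: ('v, 'k::field) mpoly ring)" by (rule ring_axioms)
    show "subgroup (vars_power V S d) (add_monoid (mpoly_ring V :: ('v, 'k::field) mpoly ring))"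
    proof (rule add.subgroupI)
      show "vars_power V S d \<subseteq> carrier (mpoly_ring V)" by (auto simp: vars_power_def)
      have "0 \<in> vars_power V S d" by (simp add: vars_power_def in_mpoly_ring)
      then show "vars_power V S d \<noteq> {}" by blast
      show "f \<oplus>\<^bsub>mpoly_ring V\<^esub> g \<in> vars_power V S d"
        if "f \<in> vars_power V S d" "g \<in> vars_power V S d" for f g :: "('v, 'k) mpoly"
        using that Poly_Mapping.keys_add[of f g] a_closed[of f g] by (auto simp: vars_power_def)
      show "\<ominus>\<^bsub>mpoly_ring V\<^esub> f \<in> vars_power V S d"
        if "f \<in> vars_power V S d" for f :: "('v, 'k) mpoly"
      proof -
        have f: "f \<in> carrier (mpoly_ring V)" "- f \<in> carrier (mpoly_ring V)"
          using that by (simp_all add: vars_power_def in_mpoly_ring)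
        then have "\<ominus>\<^bsub>mpoly_ring V\<^esub> f = - f"
          by (intro minus_equality) simp_all
        then show ?thesis using that f by (simp add: vars_power_def)
      qed
    qed
    show "g \<otimes>\<^bsub>mpoly_ring V\<^esub> f \<in> vars_power V S d"
      if "f \<in> vars_power V S d" "g \<in> carrier (mpoly_ring V)" for f g :: "('v, 'k) mpoly"
      using vars_power_mult[of g V S 0 f d] that by simp
    show "f \<otimes>\<^bsub>mpoly_ring V\<^esub> g \<in> vars_power V S d"
      if "f \<in> vars_power V S d" "g \<in> carrier (mpoly_ring V)" for f g :: "('v, 'k) mpoly"
      using vars_power_mult[of f V S d g 0] that by simp
  qed
qed

text \<open>
  The lowest homogeneous part of \<open>f * g\<close>, graded by the degree in \<open>S\<close>, is the product of the lowest parts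
  of \<open>f\<close> and \<open>g\<close>, because polynomial rings have no zero divisors. If \<open>g\<close> had a term of degree \<open>0\<close>, then
  \<open>f * g\<close> would have a term of the same degree as the lowest terms of \<open>f\<close>. The linear order on the
  variables makes the polynomials an instance of \<^class>\<open>idom\<close>.
\<close>

lemma vars_power_primary:
  fixes f g :: "('v::linorder, 'k::field) mpoly"
  assumes f: "f \<in> carrier (mpoly_ring V)" and g: "g \<in> carrier (mpoly_ring V)"
    and fg: "f * g \<in> vars_power V S d" and nf: "f \<notin> vars_power V S d"
  shows "g \<in> vars_power V S 1"
proof (rule ccontr)
  assume "g \<notin> vars_power V S 1"
  then obtain y where y: "y \<in> Poly_Mapping.keys g" "degree_in S y = 0"
    using g by (auto simp: vars_power_def Suc_le_eq)
  obtain x' where x': "x' \<in> Poly_Mapping.keys f" "degree_in S x' < d"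
    using nf f by (auto simp: vars_power_def not_le)
  obtain x where x: "x \<in> Poly_Mapping.keys f"
    and x_min: "\<And>k. k \<in> Poly_Mapping.keys f \<Longrightarrow> degree_in S x \<le> degree_in S k"
    using ex_has_least_nat[of "\<lambda>k. k \<in> Poly_Mapping.keys f" x' "degree_in S"] x'(1) by blast
  let ?a = "degree_in S x"
  have "?a < d" using x_min[OF x'(1)] x'(2) by simp
  \<comment> \<open>The lowest parts: degree \<open>?a\<close> in \<open>f\<close>, and degree \<open>0\<close> in \<open>g\<close>.\<close>
  define f0 where "f0 = Poly_Mapping.mapp (\<lambda>k c. c when degree_in S k = ?a) f"
  define g0 where "g0 = Poly_Mapping.mapp (\<lambda>k c. c when degree_in S k = 0) g"
  have f0: "Poly_Mapping.lookup f0 k = (Poly_Mapping.lookup f k when degree_in S k = ?a)" for k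
    by (simp add: f0_def lookup_mapp in_keys_iff when_def)
  have g0: "Poly_Mapping.lookup g0 k = (Poly_Mapping.lookup g k when degree_in S k = 0)" for k
    by (simp add: g0_def lookup_mapp in_keys_iff when_def)
  have "f0 \<noteq> 0" "g0 \<noteq> 0"
    using x y f0[of x] g0[of y] by (auto simp: in_keys_iff)
  then have "f0 * g0 \<noteq> 0" by simp
  then obtain k where k: "k \<in> Poly_Mapping.keys (f0 * g0)"
    by (metis all_not_in_conv keys_eq_empty)
  then have deg_k: "degree_in S k = ?a"
    using keys_mult[of f0 g0] f0 g0 by (fastforce simp: in_keys_iff degree_in_add)
  have high_f: "?a < degree_in S l" if "l \<in> Poly_Mapping.keys (f - f0)" for l
    using that x_min[of l] f0[of l] by (auto simp: in_keys_iff lookup_minus when_def split: if_splits)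
  have low_f0: "?a \<le> degree_in S l" if "l \<in> Poly_Mapping.keys f0" for l
    using that f0[of l] by (auto simp: in_keys_iff when_def split: if_splits)
  have high_g: "0 < degree_in S l" if "l \<in> Poly_Mapping.keys (g - g0)" for l
    using that g0[of l] by (auto simp: in_keys_iff lookup_minus when_def split: if_splits)
  have "k \<notin> Poly_Mapping.keys (f0 * (g - g0))"
    using keys_mult[of f0 "g - g0"] low_f0 high_g deg_k by (fastforce simp: degree_in_add)
  moreover have "k \<notin> Poly_Mapping.keys ((f - f0) * g)"
    using keys_mult[of "f - f0" g] high_f deg_k by (fastforce simp: degree_in_add)
  moreover have "f * g = f0 * g0 + (f0 * (g - g0) + (f - f0) * g)"
    by (simp add: algebra_simps)
  ultimately have "k \<in> Poly_Mapping.keys (f * g)"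
    using k by (simp add: in_keys_iff lookup_add)
  then show False
    using fg deg_k \<open>?a < d\<close> by (auto simp: vars_power_def)
qed

lemma vars_power_1_primeideal:
  "primeideal (vars_power V S 1) (mpoly_ring V :: ('v::linorder, 'k::field) mpoly ring)"
proof (rule primeidealI)
  show "ideal (vars_power V S 1) (mpoly_ring V :: ('v, 'k) mpoly ring)"
    by (rule vars_power_ideal)
  show "cring (mpoly_ring V :: ('v, 'k) mpoly ring)" by (rule mpoly_ring_cring)
  have "(1 :: ('v, 'k) mpoly) \<in> carrier (mpoly_ring V) - vars_power V S 1"
    by (simp add: vars_power_def in_mpoly_ring)
  then show "carrier (mpoly_ring V) \<noteq> (vars_power V S 1 :: ('v, 'k) mpoly set)" by blast
  show "f \<in> vars_power V S 1 \<or> g \<in> vars_power V S 1"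
    if "f \<in> carrier (mpoly_ring V)" "g \<in> carrier (mpoly_ring V)"
      "f \<otimes>\<^bsub>mpoly_ring V\<^esub> g \<in> vars_power V S 1" for f g :: "('v, 'k) mpoly"
    using that vars_power_primary[of f V g S 1] by auto
qed

lemma var_in_carrier: "i \<in> V \<Longrightarrow> var i \<in> carrier (mpoly_ring V)"
  by (simp add: var_def in_mpoly_ring)

lemma var_in_vars_power:
  assumes "finite S"
  shows "var i \<in> vars_power V S 1 \<longleftrightarrow> i \<in> V \<inter> S"
  using assms by (auto simp: vars_power_def var_def in_mpoly_ring degree_in_pos[simplified])

lemma single_in_idealI:
  fixes J :: "('v, 'k::field) mpoly set"
  assumes "ideal J (mpoly_ring V)" "Poly_Mapping.single k 1 \<in> J"
    and "Poly_Mapping.keys l \<subseteq> V" and le: "\<And>i. Poly_Mapping.lookup k i \<le> Poly_Mapping.lookup l i"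
  shows "Poly_Mapping.single l 1 \<in> J"
proof -
  have l: "l = (l - k) + k"
    by (rule poly_mapping_eqI) (simp add: lookup_add lookup_minus le)
  have "Poly_Mapping.keys (l - k) \<subseteq> V"
    using assms(3) by (force simp: in_keys_iff lookup_minus)
  then have "Poly_Mapping.single (l - k) 1 * Poly_Mapping.single k 1 \<in> J"
    using ideal.I_l_closed[OF assms(1,2) single_in_mpoly_ring] by simp
  then show ?thesis by (subst l) (simp add: mult_single)
qed

lemma vars_power_1_subset:
  fixes J :: "('v, 'k::field) mpoly set"
  assumes "ideal J (mpoly_ring V)" "finite S" "\<And>i. i \<in> V \<inter> S \<Longrightarrow> var i \<in> J"
  shows "vars_power V S 1 \<subseteq> J"
proof
  fix f :: "('v, 'k) mpoly" assume f: "f \<in> vars_power V S 1"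
  show "f \<in> J"
  proof (rule ideal_memI_monomials[OF assms(1)])
    show "f \<in> carrier (mpoly_ring V)" using f by (simp add: vars_power_def)
    fix k assume "k \<in> Poly_Mapping.keys f"
    then have k: "Poly_Mapping.keys k \<subseteq> V" "1 \<le> degree_in S k"
      using f by (auto simp: vars_power_def in_mpoly_ring)
    then obtain i where i: "i \<in> Poly_Mapping.keys k" "i \<in> S"
      using degree_in_pos[OF assms(2)] by blast
    then have "var i \<in> J" using assms(3) k by blast
    then show "Poly_Mapping.single k 1 \<in> J"
      using i k(1) by (intro single_in_idealI[OF assms(1), of "Poly_Mapping.single i 1" k])
        (auto simp: var_def lookup_single when_def in_keys_iff Suc_le_eq)
  qed
qed

lemma vars_power_1_monomial_ideal:
  assumes "finite S" "S \<subseteq> V"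
  shows "monomial_ideal V (vars_power V S 1 :: ('v, 'k::field) mpoly set)"
proof -
  interpret cring "mpoly_ring V :: ('v, 'k) mpoly ring" by (rule mpoly_ring_cring)
  have sub: "(var ` S :: ('v, 'k) mpoly set) \<subseteq> carrier (mpoly_ring V)"
    using assms(2) by (auto intro: var_in_carrier)
  have "vars_power V S 1 = Idl\<^bsub>mpoly_ring V\<^esub> (var ` S :: ('v, 'k) mpoly set)"
  proof
    show "vars_power V S 1 \<subseteq> Idl\<^bsub>mpoly_ring V\<^esub> (var ` S :: ('v, 'k) mpoly set)"
      using genideal_self[OF sub]
      by (intro vars_power_1_subset[OF genideal_ideal[OF sub] assms(1)]) blast
    show "Idl\<^bsub>mpoly_ring V\<^esub> (var ` S :: ('v, 'k) mpoly set) \<subseteq> vars_power V S 1"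
      using assms by (intro genideal_minimal[OF vars_power_ideal] image_subsetI)
        (subst var_in_vars_power, auto)
  qed
  moreover have "(var ` S :: ('v, 'k) mpoly set) \<subseteq> monomials V"
  proof (rule image_subsetI)
    fix i assume "i \<in> S"
    then show "(var i :: ('v, 'k) mpoly) \<in> monomials V"
      using assms(2) unfolding var_def monomials_def mem_Collect_eq
      by (intro exI[of _ "Poly_Mapping.single i 1"]) auto
  qed
  ultimately show ?thesis by (auto simp: monomial_ideal_def)
qed


section \<open>Dominating ideals as intersections of neighbourhood primes\<close>

definition squarefree_exponent :: "'v set \<Rightarrow> ('v \<Rightarrow>\<^sub>0 nat)" where
  "squarefree_exponent S = (\<Sum>i\<in>S. Poly_Mapping.single i 1)"

lemma lookup_squarefree_exponent:
  "finite S \<Longrightarrow> Poly_Mapping.lookup (squarefree_exponent S) j = (if j \<in> S then 1 else 0)"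
  by (simp add: squarefree_exponent_def lookup_sum lookup_single when_def)

lemma keys_squarefree_exponent [simp]:
  "finite S \<Longrightarrow> Poly_Mapping.keys (squarefree_exponent S) = S"
  by (auto simp: in_keys_iff lookup_squarefree_exponent split: if_splits)

lemma prod_var:
  assumes "finite S"
  shows "(\<Prod>i\<in>S. var i) = Poly_Mapping.single (squarefree_exponent S) 1"
  using assms by (induction S rule: finite_induct) 
    (simp_all add: var_def mult_single squarefree_exponent_def)

lemma prod_var_in_vars_power_1:
  assumes "finite S" "finite T" "S \<subseteq> V"
  shows "(\<Prod>i\<in>S. var i) \<in> vars_power V T 1 \<longleftrightarrow> S \<inter> T \<noteq> {}"
  using assms degree_in_pos[OF assms(2), of "squarefree_exponent S"]
  by (simp add: prod_var vars_power_def in_mpoly_ring)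

lemma prime_prod_var:
  assumes Q: "primeideal Q (mpoly_ring V)"
    and "finite S" "S \<subseteq> V" "(\<Prod>i\<in>S. var i) \<in> Q"
  shows "\<exists>i\<in>S. var i \<in> Q"
  using assms(2-4)
proof (induction S rule: finite_induct)
  case empty
  then show ?case
    using ideal.one_imp_carrier[OF primeideal.axioms(1)[OF Q]] primeideal.I_notcarr[OF Q] by simp
next
  case (insert j S)
  have "(\<Prod>i\<in>S. var i) \<in> carrier (mpoly_ring V)"
    using insert by (simp add: prod_var in_mpoly_ring)
  then show ?case
    using insert primeideal.I_prime[OF Q var_in_carrier, of j "\<Prod>i\<in>S. var i"] by auto
qed

lemma minimal_dominating_subset:
  assumes "finite S" "dominating_set G S"
  shows "\<exists>T \<subseteq> S. minimal_dominating_set G T"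
  using assms
proof (induction S rule: finite_psubset_induct)
  case (psubset S)
  show ?case
  proof (cases "minimal_dominating_set G S")
    case False
    then obtain T where T: "T \<subset> S" "dominating_set G T"
      using psubset.prems by (auto simp: minimal_dominating_set_def)
    then obtain U where "U \<subseteq> T" "minimal_dominating_set G U"
      using psubset.IH by blast
    then show ?thesis using T by blast
  qed blast
qed

lemma (in wf_digraph) closed_nbhd_subset:
  "v \<in> verts G \<Longrightarrow> closed_nbhd G v \<subseteq> verts G"
  by (auto simp: closed_nbhd_def dest: adj_in_verts)

text \<open>
  A monomial lies in every neighbourhood prime iff its support meets every closed neighbourhood, i.e. is
  dominating. The support then contains a minimal dominating set, so the monomial is a multiple of a
  generator.
\<close>

lemma (in fin_digraph) dominating_ideal_eq_Inter:
  "(dominating_ideal G :: ('a, 'k::field) mpoly set) =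
    {f \<in> carrier (mpoly_ring (verts G)).
      \<forall>v \<in> verts G. f \<in> vars_power (verts G) (closed_nbhd G v) 1}" (is "?D = ?I")
proof -
  let ?V = "verts G"
  let ?R = "mpoly_ring ?V :: ('a, 'k) mpoly ring"
  let ?M = "{\<Prod>v\<in>S. var v | S. minimal_dominating_set G S} :: ('a, 'k) mpoly set"
  interpret R: cring ?R by (rule mpoly_ring_cring)
  have finN: "finite (closed_nbhd G v)" if "v \<in> ?V" for v
    using closed_nbhd_subset[OF that] finite_verts by (rule finite_subset)
  have dom: "S \<subseteq> ?V" "finite S" "\<And>v. v \<in> ?V \<Longrightarrow> S \<inter> closed_nbhd G v \<noteq> {}"
    if "minimal_dominating_set G S" for S
    using that finite_subset[of S ?V]
    by (auto simp: minimal_dominating_set_def dominating_set_def)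
  have MI: "g \<in> ?I" if g: "g \<in> ?M" for g
  proof -
    obtain S where S: "minimal_dominating_set G S" "g = (\<Prod>v\<in>S. var v)"
      using g by blast
    note S' = dom[OF S(1)]
    have "g \<in> carrier ?R"
      using S' unfolding S(2) by (simp add: prod_var in_mpoly_ring)
    moreover have "g \<in> vars_power ?V (closed_nbhd G v) 1" if "v \<in> ?V" for v
      unfolding S(2) using prod_var_in_vars_power_1[OF S'(2) finN[OF that] S'(1)] S'(3)[OF that]
      by simp
    ultimately show ?thesis by blast
  qed
  then have sub: "?M \<subseteq> carrier ?R" by blast
  have D: "?D = Idl\<^bsub>?R\<^esub> ?M" by (simp add: dominating_ideal_def)
  show ?thesis
  proof
    have "?D \<subseteq> vars_power ?V (closed_nbhd G v) 1" if "v \<in> ?V" for v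
      unfolding D using MI that by (intro R.genideal_minimal[OF vars_power_ideal] subsetI) simp
    moreover have "?D \<subseteq> carrier ?R"
      unfolding D by (intro R.genideal_minimal[OF R.oneideal] sub)
    ultimately show "?D \<subseteq> ?I" by blast
  next
    have Dideal: "ideal ?D ?R" unfolding D by (rule R.genideal_ideal[OF sub])
    show "?I \<subseteq> ?D"
    proof (rule subsetI, rule ideal_memI_monomials[OF Dideal])
      fix f :: "('a, 'k) mpoly" and k
      assume f: "f \<in> ?I" and k: "k \<in> Poly_Mapping.keys f"
      have kV: "Poly_Mapping.keys k \<subseteq> ?V" using f k by (simp add: in_mpoly_ring)
      have "Poly_Mapping.keys k \<inter> closed_nbhd G v \<noteq> {}" if "v \<in> ?V" for v
        using f k that degree_in_pos[OF finN[OF that], of k] by (simp add: vars_power_def)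
      then have "dominating_set G (Poly_Mapping.keys k)"
        using kV by (simp add: dominating_set_def)
      then obtain S where S: "S \<subseteq> Poly_Mapping.keys k" "minimal_dominating_set G S"
        using minimal_dominating_subset[OF finite_keys] by blast
      then have "(\<Prod>v\<in>S. var v :: ('a, 'k) mpoly) \<in> ?D"
        unfolding D using R.genideal_self[OF sub] by blast
      then have "Poly_Mapping.single (squarefree_exponent S) 1 \<in> ?D"
        using dom(2)[OF S(2)] by (simp add: prod_var)
      then show "Poly_Mapping.single k 1 \<in> ?D"
      proof (rule single_in_idealI[OF Dideal _ kV])
        show "Poly_Mapping.lookup (squarefree_exponent S) j \<le> Poly_Mapping.lookup k j" for j
          using S(1) dom(2)[OF S(2)] by (auto simp: lookup_squarefree_exponent in_keys_iff Suc_le_eq)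
      qed
    qed simp
  qed
qed

lemma (in fin_digraph) dominating_ideal_ideal:
  "ideal (dominating_ideal G :: ('a, 'k::field) mpoly set) (mpoly_ring (verts G))"
  and dominating_ideal_monomial_ideal:
  "monomial_ideal (verts G) (dominating_ideal G :: ('a, 'k::field) mpoly set)"
proof -
  let ?R = "mpoly_ring (verts G) :: ('a, 'k) mpoly ring"
  let ?M = "{\<Prod>v\<in>S. var v | S. minimal_dominating_set G S} :: ('a, 'k) mpoly set"
  interpret R: cring ?R by (rule mpoly_ring_cring)
  have mon: "?M \<subseteq> monomials (verts G)"
  proof
    fix g assume "g \<in> ?M"
    then obtain S where S: "minimal_dominating_set G S" "g = (\<Prod>v\<in>S. var v)" by blast
    have "S \<subseteq> verts G" "finite S"
      using S(1) finite_subset[of S "verts G"]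
      by (auto simp: minimal_dominating_set_def dominating_set_def)
    then show "g \<in> monomials (verts G)"
      unfolding S(2) monomials_def mem_Collect_eq
      by (intro exI[of _ "squarefree_exponent S"]) (simp add: prod_var)
  qed
  then show "monomial_ideal (verts G) (dominating_ideal G :: ('a, 'k::field) mpoly set)"
    unfolding monomial_ideal_def dominating_ideal_def by blast
  have "?M \<subseteq> carrier ?R"
    using mon by (rule order_trans) (auto simp: monomials_def in_mpoly_ring)
  then show "ideal (dominating_ideal G :: ('a, 'k::field) mpoly set) ?R"
    unfolding dominating_ideal_def by (rule R.genideal_ideal)
qed

lemma associated_primes_dominating_ideal:
  fixes G :: "('v::linorder, 'e) pre_digraph"
  assumes "fin_digraph G"
  shows "associated_primes (mpoly_ring (verts G))
      (quotient_module (mpoly_ring (verts G)) (dominating_ideal G :: ('v, 'k::field) mpoly set)) =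
    minimal_primes (mpoly_ring (verts G)) (dominating_ideal G)"
proof -
  interpret fin_digraph G by fact
  interpret R: cring "mpoly_ring (verts G) :: ('v, 'k) mpoly ring" by (rule mpoly_ring_cring)
  show ?thesis
  proof (rule R.associated_primes_Inter_primes)
    show "finite ((\<lambda>v. vars_power (verts G) (closed_nbhd G v) 1 :: ('v, 'k) mpoly set) ` verts G)"
      by simp
    show "dominating_ideal G = {g \<in> carrier (mpoly_ring (verts G)).
        \<forall>Q \<in> (\<lambda>v. vars_power (verts G) (closed_nbhd G v) 1 :: ('v, 'k) mpoly set) ` verts G. g \<in> Q}"
      by (simp add: dominating_ideal_eq_Inter)
  qed (use vars_power_1_primeideal dominating_ideal_ideal in auto)
qed


section \<open>Complete bipartite graphs\<close>

text \<open>
  For disjoint non-empty finite \<open>A\<close> and \<open>B\<close>, the dominating ideal of the complete bipartite graph on these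
  parts, as the intersection of its neighbourhood primes. It is generated by the products over \<open>A\<close> and over \<open>B\<close> and the products
  \<open>x_a x_b\<close>. This form is symmetric in \<open>A\<close> and \<open>B\<close> and needs no case distinction for parts of size one.
\<close>

definition crossing_ideal :: "'v set \<Rightarrow> 'v set \<Rightarrow> ('v, 'k::field) mpoly set" where
  "crossing_ideal A B =
    {f \<in> carrier (mpoly_ring (A \<union> B)).
      (\<forall>a \<in> A. f \<in> vars_power (A \<union> B) (insert a B) 1) \<and>
      (\<forall>b \<in> B. f \<in> vars_power (A \<union> B) (insert b A) 1)}"

lemma crossing_ideal_commute: "crossing_ideal A B = crossing_ideal B A"
  by (auto simp: crossing_ideal_def Un_commute)

lemma crossing_ideal_ideal:
  "ideal (crossing_ideal A B :: ('v, 'k::field) mpoly set) (mpoly_ring (A \<union> B))"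
proof -
  let ?R = "mpoly_ring (A \<union> B) :: ('v, 'k) mpoly ring"
  interpret R: cring ?R by (rule mpoly_ring_cring)
  let ?F = "insert (carrier ?R) ((\<lambda>a. vars_power (A \<union> B) (insert a B) 1) ` A \<union>
    (\<lambda>b. vars_power (A \<union> B) (insert b A) 1) ` B)"
  have "ideal (\<Inter>?F) ?R"
    by (rule R.i_Intersect) (use R.oneideal vars_power_ideal in auto)
  moreover have "crossing_ideal A B = \<Inter>?F"
    by (auto simp: crossing_ideal_def)
  ultimately show ?thesis by simp
qed

lemma var_mult_var_in_crossing_ideal:
  assumes "finite A" "finite B" "v \<in> A" "b \<in> B"
  shows "(var v * var b :: ('v, 'k::field) mpoly) \<in> crossing_ideal A B"
proof -
  let ?V = "A \<union> B"
  have c: "(var v :: ('v, 'k) mpoly) \<in> vars_power ?V S 0" "(var b :: ('v, 'k) mpoly) \<in> vars_power ?V S 0" for S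
    using assms var_in_carrier[of v ?V] var_in_carrier[of b ?V] by simp_all
  have "(var v * var b :: ('v, 'k) mpoly) \<in> vars_power ?V (insert a B) 1" for a
  proof -
    have "var b \<in> vars_power ?V (insert a B) 1"
      using assms by (subst var_in_vars_power) auto
    then show ?thesis using vars_power_mult[OF c(1), of "var b" "insert a B" 1] by simp
  qed
  moreover have "(var v * var b :: ('v, 'k) mpoly) \<in> vars_power ?V (insert b' A) 1" for b'
  proof -
    have "var v \<in> vars_power ?V (insert b' A) 1"
      using assms by (subst var_in_vars_power) auto
    then show ?thesis using vars_power_mult[OF _ c(2), of "var v" "insert b' A" 1] by simp
  qed
  moreover have "(var v * var b :: ('v, 'k) mpoly) \<in> carrier (mpoly_ring ?V)"
    using vars_power_mult[OF c(1) c(2)] by simp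
  ultimately show ?thesis by (simp add: crossing_ideal_def)
qed

lemma prod_var_in_crossing_ideal:
  assumes "finite A" "finite B" "A \<noteq> {}"
  shows "(\<Prod>i\<in>A. var i :: ('v, 'k::field) mpoly) \<in> crossing_ideal A B"
proof -
  let ?V = "A \<union> B"
  have "(\<Prod>i\<in>A. var i :: ('v, 'k) mpoly) \<in> vars_power ?V (insert a B) 1" if "a \<in> A" for a
    using assms that by (subst prod_var_in_vars_power_1) auto
  moreover have "(\<Prod>i\<in>A. var i :: ('v, 'k) mpoly) \<in> vars_power ?V (insert b A) 1" for b
    using assms by (subst prod_var_in_vars_power_1) auto
  moreover have "(\<Prod>i\<in>A. var i :: ('v, 'k) mpoly) \<in> carrier (mpoly_ring ?V)"
    using assms by (simp add: prod_var in_mpoly_ring)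
  ultimately show ?thesis by (simp add: crossing_ideal_def)
qed

lemma crossing_ideal_power_subset:
  assumes "a \<in> A"
  shows "crossing_ideal A B [^]\<^bsub>ideals_set (mpoly_ring (A \<union> B))\<^esub> (m::nat)
    \<subseteq> (vars_power (A \<union> B) (insert a B) m :: ('v, 'k::field) mpoly set)"
proof (induction m)
  case (Suc m)
  show ?case
  proof
    fix f :: "('v, 'k) mpoly"
    assume "f \<in> crossing_ideal A B [^]\<^bsub>ideals_set (mpoly_ring (A \<union> B))\<^esub> Suc m"
    then have "f \<in> ideal_prod (mpoly_ring (A \<union> B))
        (crossing_ideal A B [^]\<^bsub>ideals_set (mpoly_ring (A \<union> B))\<^esub> m) (crossing_ideal A B)"
      by simp
    then show "f \<in> vars_power (A \<union> B) (insert a B) (Suc m)"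
    proof (induction f rule: ideal_prod.induct)
      case (prod g h)
      have "h \<in> vars_power (A \<union> B) (insert a B) 1"
        using prod(2) assms by (simp add: crossing_ideal_def)
      moreover have "g \<in> vars_power (A \<union> B) (insert a B) m"
        using prod(1) Suc by blast
      ultimately show ?case using vars_power_mult[of g "A \<union> B" "insert a B" m h 1] by simp
    next
      case (sum g h)
      then show ?case
        using additive_subgroup.a_closed[OF ideal.axioms(1)[OF vars_power_ideal]] by metis
    qed
  qed
qed simp

text \<open>
  Each factor \<open>x_v\<close> pays for one generator of the ideal: as long as a variable \<open>x_b\<close>
  occurs, split off \<open>x_v x_b\<close>; once none occurs, the degree bounds make every \<open>x_a\<close> with \<open>a \<noteq> v\<close> occur
  to the power at least \<open>m\<close>, and the product over \<open>A\<close> is split off. Either way all the degrees in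
  question drop by at most one.
\<close>

lemma localised_power_monomial:
  fixes k :: "'v \<Rightarrow>\<^sub>0 nat"
  assumes fin: "finite A" "finite B" and v: "v \<in> A"
    and "Poly_Mapping.keys k \<subseteq> A \<union> B"
    and "\<And>a. a \<in> A - {v} \<Longrightarrow> m \<le> degree_in (insert a B) k"
  shows "(Poly_Mapping.single k 1 * var v ^ m :: ('v, 'k::field) mpoly)
    \<in> crossing_ideal A B [^]\<^bsub>ideals_set (mpoly_ring (A \<union> B))\<^esub> m"
  using assms(4,5)
proof (induction m arbitrary: k)
  case 0
  then show ?case by (simp add: in_mpoly_ring)
next
  case (Suc m)
  let ?I = "crossing_ideal A B :: ('v, 'k) mpoly set"
  have step: "(Poly_Mapping.single k 1 * var v ^ Suc m :: ('v, 'k) mpoly)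
      \<in> ?I [^]\<^bsub>ideals_set (mpoly_ring (A \<union> B))\<^esub> Suc m"
    if k: "k = k' + e" and deg: "\<And>a. a \<in> A - {v} \<Longrightarrow> m \<le> degree_in (insert a B) k'"
      and e: "var v * Poly_Mapping.single e 1 \<in> ?I" for k' e
  proof -
    have "Poly_Mapping.keys k' \<subseteq> Poly_Mapping.keys k"
      by (auto simp: k in_keys_iff lookup_add)
    then have "Poly_Mapping.keys k' \<subseteq> A \<union> B" using Suc.prems(1) by (rule order_trans)
    then have "Poly_Mapping.single k' 1 * var v ^ m
        \<in> ?I [^]\<^bsub>ideals_set (mpoly_ring (A \<union> B))\<^esub> m"
      using deg by (rule Suc.IH)
    then have "(Poly_Mapping.single k' 1 * var v ^ m) * (var v * Poly_Mapping.single e 1)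
        \<in> ?I [^]\<^bsub>ideals_set (mpoly_ring (A \<union> B))\<^esub> Suc m"
      using ideal_prod.prod[OF _ e, of _ _ "mpoly_ring (A \<union> B)"] by simp
    moreover have "Poly_Mapping.single k (1::'k) = Poly_Mapping.single k' 1 * Poly_Mapping.single e 1"
      by (simp add: k mult_single)
    ultimately show ?thesis by (simp add: mult_ac)
  qed
  show ?case
  proof (cases "\<exists>b \<in> B. 1 \<le> Poly_Mapping.lookup k b")
    case True
    then obtain b where b: "b \<in> B" "1 \<le> Poly_Mapping.lookup k b" by blast
    let ?e = "Poly_Mapping.single b (1::nat)"
    have k: "k = (k - ?e) + ?e"
      using b(2) by (intro poly_mapping_eqI) (auto simp: lookup_add lookup_minus lookup_single when_def)
    have e: "(var v * Poly_Mapping.single ?e 1 :: ('v, 'k) mpoly) \<in> ?I"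
      using var_mult_var_in_crossing_ideal[OF fin v b(1)] by (simp add: var_def)
    show ?thesis
    proof (rule step[OF k _ e])
      fix a assume "a \<in> A - {v}"
      then have "Suc m \<le> degree_in (insert a B) ((k - ?e) + ?e)"
        using Suc.prems(2) k by simp
      then show "m \<le> degree_in (insert a B) (k - ?e)"
        using b(1) fin by (simp add: degree_in_add degree_in_single)
    qed
  next
    case False
    let ?e = "squarefree_exponent (A - {v})"
    \<comment> \<open>No variable of \<open>B\<close> is left, so the degree in \<open>insert a B\<close> is the exponent of \<open>a\<close>.\<close>
    have large: "Suc m \<le> Poly_Mapping.lookup k a" if a: "a \<in> A - {v}" for a
    proof -
      have "degree_in (insert a B) k = Poly_Mapping.lookup k a"
        unfolding degree_in_def using False fin
        by (subst sum.mono_neutral_right[of _ "{a}"]) (auto simp: Suc_le_eq)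
      then show ?thesis using Suc.prems(2)[OF a] by simp
    qed
    have k: "k = (k - ?e) + ?e"
    proof (rule poly_mapping_eqI)
      show "Poly_Mapping.lookup k j = Poly_Mapping.lookup ((k - ?e) + ?e) j" for j
        using large[of j] fin by (auto simp: lookup_add lookup_minus lookup_squarefree_exponent)
    qed
    have "var v * Poly_Mapping.single ?e 1 = (\<Prod>i\<in>A. var i :: ('v, 'k) mpoly)"
      using fin v by (simp add: prod_var[symmetric] prod.remove)
    then have e: "(var v * Poly_Mapping.single ?e 1 :: ('v, 'k) mpoly) \<in> ?I"
      using prod_var_in_crossing_ideal[OF fin] v by force
    show ?thesis
    proof (rule step[OF k _ e])
      fix a assume a: "a \<in> A - {v}"
      then have "m \<le> Poly_Mapping.lookup (k - ?e) a"
        using large[OF a] fin by (simp add: lookup_minus lookup_squarefree_exponent)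
      also have "\<dots> \<le> degree_in (insert a B) (k - ?e)"
        using fin by (intro lookup_le_degree_in) auto
      finally show "m \<le> degree_in (insert a B) (k - ?e)" .
    qed
  qed
qed

text \<open>
  Passes from monomials to polynomials: the \<open>f\<close> with \<open>f * var v ^ m \<in> I^m\<close> form a colon ideal, and an ideal
  contains \<open>f\<close> as soon as it contains the monomials of \<open>f\<close>.
\<close>

lemma localised_power:
  fixes f :: "('v, 'k::field) mpoly"
  assumes fin: "finite A" "finite B" and v: "v \<in> A"
    and f: "f \<in> carrier (mpoly_ring (A \<union> B))"
    and deg: "\<And>a. a \<in> A - {v} \<Longrightarrow> f \<in> vars_power (A \<union> B) (insert a B) m"
  shows "f * var v ^ m \<in> crossing_ideal A B [^]\<^bsub>ideals_set (mpoly_ring (A \<union> B))\<^esub> m"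
proof -
  let ?R = "mpoly_ring (A \<union> B) :: ('v, 'k) mpoly ring"
  let ?I = "crossing_ideal A B [^]\<^bsub>ideals_set ?R\<^esub> m :: ('v, 'k) mpoly set"
  interpret R: cring ?R by (rule mpoly_ring_cring)
  have vm: "var v ^ m \<in> carrier ?R"
    using R.nat_pow_closed[OF var_in_carrier, of v m] v by simp
  have "f \<in> colon ?R ?I (var v ^ m)"
  proof (rule ideal_memI_monomials[OF _ f])
    show "ideal (colon ?R ?I (var v ^ m)) ?R"
      by (intro R.colon_ideal R.ideal_power_ideal crossing_ideal_ideal vm)
    fix k assume k: "k \<in> Poly_Mapping.keys f"
    then have kV: "Poly_Mapping.keys k \<subseteq> A \<union> B" using f by (simp add: in_mpoly_ring)
    have "Poly_Mapping.single k 1 * var v ^ m \<in> ?I"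
      using deg k by (intro localised_power_monomial[OF fin v kV]) (auto simp: vars_power_def)
    then show "Poly_Mapping.single k 1 \<in> colon ?R ?I (var v ^ m)"
      using single_in_mpoly_ring[OF kV] by (simp add: colon_def)
  qed
  then show ?thesis by (simp add: colon_def)
qed

text \<open>
  Modulo \<open>Q\<close>, the products \<open>x_v x_b\<close> vanish and \<open>x_v\<close> does not, so all \<open>x_b\<close> vanish; the product over \<open>A\<close>
  forces one more variable \<open>x_a\<close> to vanish.
\<close>

lemma prime_over_crossing_ideal:
  fixes Q :: "('v, 'k::field) mpoly set"
  assumes fin: "finite A" "finite B" and v: "v \<in> A"
    and Q: "primeideal Q (mpoly_ring (A \<union> B))"
    and IQ: "crossing_ideal A B \<subseteq> Q" and vQ: "var v \<notin> Q"
  shows "\<exists>a \<in> A - {v}. vars_power (A \<union> B) (insert a B) 1 \<subseteq> Q"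
proof -
  interpret Q: primeideal Q "mpoly_ring (A \<union> B)" by fact
  have B: "var b \<in> Q" if b: "b \<in> B" for b
  proof -
    have "var v * var b \<in> Q"
      using var_mult_var_in_crossing_ideal[OF fin v b] IQ by blast
    then show ?thesis
      using Q.I_prime[OF var_in_carrier var_in_carrier, of v b] v b vQ by simp
  qed
  have "(\<Prod>i\<in>A. var i) \<in> Q"
    using prod_var_in_crossing_ideal[OF fin] v IQ by blast
  then obtain a where a: "a \<in> A" "var a \<in> Q"
    using prime_prod_var[OF Q fin(1)] by blast
  have "vars_power (A \<union> B) (insert a B) 1 \<subseteq> Q"
    using B a(2) fin by (intro vars_power_1_subset Q.ideal_axioms) auto
  moreover have "a \<noteq> v" using a(2) vQ by blast
  ultimately show ?thesis using a(1) by blast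
qed

text \<open>
  A prime \<open>Q\<close> over \<open>I\<close> inside \<open>(x_a, x_b : b \<in> B)\<close> misses \<open>x_v\<close>, hence contains some \<open>(x_a', x_b : b \<in> B)\<close>,
  and disjointness of the parts forces \<open>a' = a\<close>. The second vertex \<open>v\<close> of \<open>A\<close> is essential: if
  \<open>A = {a}\<close> and \<open>B\<close> has at least two elements, the prime properly contains every \<open>(x_a, x_b)\<close>.
\<close>

lemma neighbourhood_prime_minimal:
  fixes A B :: "'v::linorder set"
  assumes fin: "finite A" "finite B" and disj: "A \<inter> B = {}"
    and v: "v \<in> A" and a: "a \<in> A - {v}"
  shows "(vars_power (A \<union> B) (insert a B) 1 :: ('v, 'k::field) mpoly set)
    \<in> minimal_primes (mpoly_ring (A \<union> B)) (crossing_ideal A B)"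
proof -
  let ?P = "\<lambda>a. vars_power (A \<union> B) (insert a B) 1 :: ('v, 'k) mpoly set"
  have var_P: "var i \<in> ?P a \<longleftrightarrow> i \<in> insert a B" if "i \<in> A" for i
    using that fin by (subst var_in_vars_power) auto
  have "Q = ?P a"
    if Q: "primeideal Q (mpoly_ring (A \<union> B))" "crossing_ideal A B \<subseteq> Q" "Q \<subseteq> ?P a" for Q
  proof -
    have "var v \<notin> Q" using var_P[OF v] Q(3) a v disj by blast
    then obtain a' where a': "a' \<in> A - {v}" "?P a' \<subseteq> Q"
      using prime_over_crossing_ideal[OF fin v Q(1,2)] by blast
    have "var a' \<in> ?P a'" using a'(1) fin by (subst var_in_vars_power) auto
    then have "var a' \<in> ?P a" using a'(2) Q(3) by blast
    then have "a' = a" using var_P[of a'] a'(1) disj by blast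
    then show ?thesis using a'(2) Q(3) by blast
  qed
  moreover have "crossing_ideal A B \<subseteq> ?P a"
    using a by (auto simp: crossing_ideal_def)
  ultimately show ?thesis
    unfolding minimal_primes_def using vars_power_1_primeideal by blast
qed

text \<open>
  The core of the proof: an associated prime of a power of \<open>I\<close> that misses a variable is minimal. The set
  \<open>J\<close> below is the \<open>m\<close>-th power of \<open>I\<close> after inverting \<open>x_v\<close>, contracted back to the polynomial ring.
\<close>

lemma prime_colon_crossing_power_minimal:
  fixes A B :: "'v::linorder set" and f :: "('v, 'k::field) mpoly"
  assumes fin: "finite A" "finite B" and disj: "A \<inter> B = {}" and v: "v \<in> A"
    and f: "f \<in> carrier (mpoly_ring (A \<union> B))"
    and P: "P = colon (mpoly_ring (A \<union> B))
      (crossing_ideal A B [^]\<^bsub>ideals_set (mpoly_ring (A \<union> B))\<^esub> (m::nat)) f"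
    and prime: "primeideal P (mpoly_ring (A \<union> B))" and vP: "var v \<notin> P"
  shows "P \<in> minimal_primes (mpoly_ring (A \<union> B)) (crossing_ideal A B)"
proof -
  let ?V = "A \<union> B"
  let ?R = "mpoly_ring ?V :: ('v, 'k) mpoly ring"
  let ?I = "crossing_ideal A B :: ('v, 'k) mpoly set"
  let ?Im = "?I [^]\<^bsub>ideals_set ?R\<^esub> m"
  interpret R: cring ?R by (rule mpoly_ring_cring)
  have I: "ideal ?I ?R" and Im: "ideal ?Im ?R"
    by (intro R.ideal_power_ideal crossing_ideal_ideal)+
  have mult_closed: "g * h \<in> carrier ?R" if "g \<in> carrier ?R" "h \<in> carrier ?R" for g h
    using R.m_closed[OF that] by simp
  define F where "F = (\<lambda>a. vars_power ?V (insert a B) m :: ('v, 'k) mpoly set) ` (A - {v})"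
  define J where "J = {g \<in> carrier ?R. \<forall>Q \<in> F. g \<in> Q}"
  \<comment> \<open>\<open>J\<close> and \<open>I^m\<close> differ by the factor \<open>x_v^m\<close>, which the prime \<open>P\<close> does not see.\<close>
  have PJ: "P = colon ?R J f"
  proof
    have "?Im \<subseteq> J"
      using crossing_ideal_power_subset[of _ A B m] ideal.Icarr[OF Im]
      by (auto simp: J_def F_def)
    then show "P \<subseteq> colon ?R J f" by (auto simp: P colon_def)
    show "colon ?R J f \<subseteq> P"
    proof
      fix g assume "g \<in> colon ?R J f"
      then have g: "g \<in> carrier ?R" "g * f \<in> J" by (auto simp: colon_def)
      have "(g * f) * var v ^ m \<in> ?Im"
        using g(2) by (intro localised_power[OF fin v]) (auto simp: J_def F_def)
      then have "(g * var v ^ m) * f \<in> ?Im" by (simp add: mult_ac)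
      moreover have vm: "var v ^ m \<in> carrier ?R"
        using R.nat_pow_closed[OF var_in_carrier, of v m] v by simp
      ultimately have "g * var v ^ m \<in> P"
        using mult_closed[OF g(1) vm] unfolding P colon_def by simp
      then have "g \<in> P \<or> var v ^ m \<in> P"
        using primeideal.I_prime[OF prime g(1) vm] by simp
      then show "g \<in> P"
        using primeideal.nat_pow_mem[OF prime var_in_carrier, of v m] v vP by auto
    qed
  qed
  have "\<exists>Q \<in> F. colon ?R J f = colon ?R Q f"
  proof (rule R.prime_colon_Inter[OF _ _ J_def f])
    show "finite F" using fin by (simp add: F_def)
    show "ideal Q ?R" if "Q \<in> F" for Q using that vars_power_ideal by (auto simp: F_def)
    show "primeideal (colon ?R J f) ?R" using prime PJ by simp
  qed
  then obtain a where a: "a \<in> A - {v}" and Pa: "P = colon ?R (vars_power ?V (insert a B) m) f"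
    using PJ by (auto simp: F_def)
  have fa: "f \<notin> vars_power ?V (insert a B) m"
  proof
    assume "f \<in> vars_power ?V (insert a B) m"
    then have "1 \<in> P" using Pa R.one_closed by (simp add: colon_def)
    then show False
      using ideal.one_imp_carrier[OF primeideal.axioms(1)[OF prime]] primeideal.I_notcarr[OF prime]
      by simp
  qed
  have "P \<subseteq> vars_power ?V (insert a B) 1"
  proof
    fix g assume "g \<in> P"
    then have "g \<in> carrier ?R" "f * g \<in> vars_power ?V (insert a B) m"
      unfolding Pa colon_def by (simp_all add: mult.commute)
    then show "g \<in> vars_power ?V (insert a B) 1"
      using vars_power_primary[OF f] fa by blast
  qed
  moreover have "?I \<subseteq> P"
  proof (rule primeideal.contains_base_of_power[OF prime I, of m])
    show "?Im \<subseteq> P"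
      using ideal.I_r_closed[OF Im _ f] ideal.Icarr[OF Im] by (auto simp: P colon_def)
  qed
  moreover have min: "vars_power ?V (insert a B) 1 \<in> minimal_primes ?R ?I"
    by (rule neighbourhood_prime_minimal[OF fin disj v a])
  ultimately have "P = vars_power ?V (insert a B) 1"
    using prime unfolding minimal_primes_def by blast
  then show ?thesis using min by simp
qed

lemma vars_power_all_1:
  assumes "finite V"
  shows "g \<in> vars_power V V 1 \<longleftrightarrow> g \<in> carrier (mpoly_ring V) \<and> 0 \<notin> Poly_Mapping.keys g"
proof -
  have "1 \<le> degree_in V k \<longleftrightarrow> k \<noteq> 0"
    if "g \<in> carrier (mpoly_ring V)" "k \<in> Poly_Mapping.keys g" for k
  proof -
    have "Poly_Mapping.keys k \<subseteq> V" using that by (simp add: in_mpoly_ring)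
    then show ?thesis
      using degree_in_pos[OF assms, of k] keys_eq_empty[of k] by (simp add: Int_absorb2)
  qed
  then show ?thesis by (auto simp: vars_power_def)
qed

text \<open>
  The variables generate a maximal ideal: an element of \<open>P\<close> with non-zero constant coefficient would put
  a unit into \<open>P\<close>.
\<close>

lemma prime_containing_all_vars:
  fixes P :: "('v, 'k::field) mpoly set"
  assumes "finite V" and P: "primeideal P (mpoly_ring V)" and vars: "\<And>v. v \<in> V \<Longrightarrow> var v \<in> P"
  shows "P = vars_power V V 1"
proof
  interpret P: primeideal P "mpoly_ring V" by fact
  show sub: "vars_power V V 1 \<subseteq> P"
    using assms by (intro vars_power_1_subset P.ideal_axioms) auto
  show "P \<subseteq> vars_power V V 1"
  proof
    fix g assume g: "g \<in> P"
    then have gc: "g \<in> carrier (mpoly_ring V)" by (rule P.a_Hcarr)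
    let ?c = "Poly_Mapping.lookup g 0"
    let ?C = "Poly_Mapping.single 0 ?c :: ('v, 'k) mpoly"
    have "?C - g \<in> carrier (mpoly_ring V)"
      using gc by (auto simp: in_keys_iff in_mpoly_ring lookup_minus lookup_single when_def split: if_splits)
    then have "?C - g \<in> vars_power V V 1"
      by (subst vars_power_all_1[OF assms(1)]) (simp add: in_keys_iff lookup_minus)
    then have "?C - g \<in> P" using sub by blast
    from additive_subgroup.a_closed[OF ideal.axioms(1)[OF P.ideal_axioms] this g]
    have C: "?C \<in> P" by simp
    have "?c = 0"
    proof (rule ccontr)
      assume "?c \<noteq> 0"
      moreover have "Poly_Mapping.single 0 (inverse ?c) * ?C \<in> P"
        using P.I_l_closed[OF C single_in_mpoly_ring[of 0 V "inverse ?c"]] by simp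
      ultimately have "1 \<in> P" by (simp add: mult_single)
      then show False using P.one_imp_carrier P.I_notcarr by simp
    qed
    then have "0 \<notin> Poly_Mapping.keys g" by (simp add: in_keys_iff)
    then show "g \<in> vars_power V V 1"
      using gc by (subst vars_power_all_1[OF assms(1)]) simp
  qed
qed

lemma associated_primes_crossing_power:
  fixes A B :: "'v::linorder set"
  assumes fin: "finite A" "finite B" and disj: "A \<inter> B = {}"
  defines "R \<equiv> mpoly_ring (A \<union> B) :: ('v, 'k::field) mpoly ring"
  shows "associated_primes R (quotient_module R (crossing_ideal A B [^]\<^bsub>ideals_set R\<^esub> (m::nat)))
    \<subseteq> minimal_primes R (crossing_ideal A B) \<union> {vars_power (A \<union> B) (A \<union> B) 1}"
proof
  interpret R: cring R unfolding R_def by (rule mpoly_ring_cring)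
  have Im: "ideal (crossing_ideal A B [^]\<^bsub>ideals_set R\<^esub> m) R"
    by (intro R.ideal_power_ideal) (simp add: R_def crossing_ideal_ideal)
  fix P assume "P \<in> associated_primes R (quotient_module R (crossing_ideal A B [^]\<^bsub>ideals_set R\<^esub> m))"
  then obtain f where prime: "primeideal P R" and f: "f \<in> carrier R"
    and P: "P = colon R (crossing_ideal A B [^]\<^bsub>ideals_set R\<^esub> m) f"
    by (auto simp: ideal.associated_primes_quotient[OF Im])
  consider v where "v \<in> A" "var v \<notin> P" | v where "v \<in> B" "var v \<notin> P"
    | "\<And>v. v \<in> A \<union> B \<Longrightarrow> var v \<in> P"
    by blast
  then show "P \<in> minimal_primes R (crossing_ideal A B) \<union> {vars_power (A \<union> B) (A \<union> B) 1}"
  proof cases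
    case 1
    then show ?thesis
      using prime_colon_crossing_power_minimal[OF fin disj _ f[unfolded R_def] P[unfolded R_def]]
        prime by (simp add: R_def)
  next
    case 2
    have R': "R = mpoly_ring (B \<union> A)" by (simp add: R_def Un_commute)
    have disj': "B \<inter> A = {}" using disj by blast
    have "P \<in> minimal_primes R (crossing_ideal B A)"
      using prime_colon_crossing_power_minimal[OF fin(2,1) disj' 2(1) f[unfolded R']
          P[unfolded R' crossing_ideal_commute[of A B]]] prime 2(2) by (simp add: R')
    then show ?thesis by (simp add: crossing_ideal_commute[of A B])
  next
    case 3
    then show ?thesis
      using prime_containing_all_vars[of "A \<union> B" P] fin prime by (simp add: R_def)
  qed
qed

theorem theorem4p4:
  fixes G :: "(nat, 'e) pre_digraph" and n r s :: nat
  assumes "verts G = {1..n}"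
    and "r \<ge> 1" and "s \<ge> 1"
    and "complete_bipartite_digraph r s G"
  shows "nearly_normally_torsion_free {1..n} (dominating_ideal G :: (nat, 'k::field) mpoly set)"
proof -
  interpret graph G
    using assms(4) by (simp add: complete_bipartite_digraph_def)
  obtain A B where AB: "verts G = A \<union> B" "A \<inter> B = {}" "arcs_ends G = A \<times> B \<union> B \<times> A"
    using assms(4) by (auto simp: complete_bipartite_digraph_def)
  have fin: "finite A" "finite B" using finite_verts AB(1) by auto
  let ?V = "verts G"
  let ?R = "mpoly_ring ?V :: (nat, 'k) mpoly ring"
  let ?D = "dominating_ideal G :: (nat, 'k) mpoly set"
  interpret R: cring ?R by (rule mpoly_ring_cring)
  have nbA: "closed_nbhd G a = insert a B" if "a \<in> A" for a
    using that AB(2) by (auto simp: closed_nbhd_def AB(3))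
  have nbB: "closed_nbhd G b = insert b A" if "b \<in> B" for b
    using that AB(2) by (auto simp: closed_nbhd_def AB(3))
  have D: "?D = crossing_ideal A B"
    unfolding dominating_ideal_eq_Inter crossing_ideal_def AB(1)
    by (simp add: ball_Un nbA nbB cong: ball_cong)
  have D1: "?D [^]\<^bsub>ideals_set ?R\<^esub> (1::nat) = ?D"
    using R.ideal_prod_one[OF dominating_ideal_ideal]
      R.ideal_prod_commute[OF dominating_ideal_ideal R.oneideal] by simp
  let ?Ass = "\<lambda>m::nat. associated_primes ?R (quotient_module ?R (?D [^]\<^bsub>ideals_set ?R\<^esub> m))"
  have "?Ass m = minimal_primes ?R ?D" if "1 \<le> m" "m \<le> 1" for m
  proof -
    have "m = 1" using that by simp
    then show ?thesis
      unfolding \<open>m = 1\<close> D1 by (intro associated_primes_dominating_ideal fin_digraph_axioms)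
  qed
  moreover have "?Ass m \<subseteq> minimal_primes ?R ?D \<union> {vars_power ?V ?V 1}" for m
    using associated_primes_crossing_power[OF fin AB(2), of m] unfolding D AB(1) .
  moreover have "primeideal (vars_power ?V ?V 1) ?R"
    by (rule vars_power_1_primeideal)
  moreover have "monomial_ideal ?V (vars_power ?V ?V 1 :: (nat, 'k) mpoly set)"
    by (rule vars_power_1_monomial_ideal) auto
  ultimately show ?thesis
    unfolding nearly_normally_torsion_free_def Let_def assms(1)[symmetric]
    by (intro conjI exI[of _ "1::nat"] exI[of _ "vars_power ?V ?V 1"] dominating_ideal_monomial_ideal)
      auto
qed

end
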